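(* There exists a probabilistic online monotone embedding from $\ell_\infty^D$ into HSTs with distortion $O(Dl)$, where $l$ is the width of the update sequence.
   Context: $\ell_\infty^D$ is $\mathbb R^D$ with $d(u,v)=\max_i|u_i-v_i|$. For $\mu\ge1$, a $\mu$-HST is the metric on the leaves of a rooted tree with node weights $\varphi\ge0$ ($\varphi(v)=0$ iff $v$ is a leaf, $\varphi(v)\le\varphi(u)/\mu$ when $v$ is a child of $u$), leaf distance $\varphi(\mathrm{lca}(u,v))$; "HSTs" is the family of such metrics. An update sequence is a sequence $(v_t,o_t)\in\mathbb R^D\times\{+,-\}$ ($v_t$ arrives if $o_t=+$, leaves if $o_t=-$) with alive sets $L_0=\varnothing$, $L_t=L_{t-1}\cup\{v_t\}$ or $L_{t-1}\setminus\{v_t\}$; its width is $\max_t|L_t|$. A deterministic online monotone embedding outputs after $\sigma_t$ (depending only on $\sigma_1,\dots,\sigma_t$) an HST metric $d_t$ on $L_t$ with $d_t\ge d$ on $L_t$ and $d_t(u,v)\le d_{t-1}(u,v)$ on $L_{t-1}\cap L_t$; a probabilistic one is a distribution over these (sequence fixed independently of the randomness). Distortion $O(Dl)$ means $\mathbb E[d_t(u,v)]\le C\,D\,l\,d(u,v)$ for an absolute constant $C$, every update sequence of width $l$, every $t$ and $u,v\in L_t$. *)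

theory Defs
  imports "HOL-Probability.Probability"
begin

type_synonym point = "real list"

definition linf_dist :: "nat \<Rightarrow> point \<Rightarrow> point \<Rightarrow> real" where
  "linf_dist D u v = Max (insert 0 ((\<lambda>i. \<bar>u ! i - v ! i\<bar>) ` {..<D}))"

text \<open>An update is a pair (v, True) for an arrival and (v, False) for a departure.\<close>
type_synonym update = "point \<times> bool"

definition alive :: "update list \<Rightarrow> point set" where
  "alive \<sigma> = foldl (\<lambda>L (v, arr). if arr then insert v L else L - {v}) {} \<sigma>"

definition valid_seq :: "nat \<Rightarrow> update list \<Rightarrow> bool" where
  "valid_seq D \<sigma> \<longleftrightarrow> (\<forall>(v, arr) \<in> set \<sigma>. length v = D)"

definition width :: "update list \<Rightarrow> nat" where
  "width \<sigma> = Max ((\<lambda>t. card (alive (take t \<sigma>))) ` {0..length \<sigma>})"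

text \<open>Tree on finite node set V with root r and parent function par;
  the children of v are the non-root nodes u with par u = v.\<close>

definition tree_leaf :: "nat set \<Rightarrow> nat \<Rightarrow> (nat \<Rightarrow> nat) \<Rightarrow> nat \<Rightarrow> bool" where
  "tree_leaf V r par v \<longleftrightarrow> v \<in> V \<and> \<not> (\<exists>u \<in> V - {r}. par u = v)"

definition tree_anc :: "nat \<Rightarrow> (nat \<Rightarrow> nat) \<Rightarrow> nat \<Rightarrow> nat \<Rightarrow> bool" where
  "tree_anc r par a v \<longleftrightarrow> (\<exists>k. (par ^^ k) v = a \<and> (\<forall>j<k. (par ^^ j) v \<noteq> r))"

definition is_lca :: "nat set \<Rightarrow> nat \<Rightarrow> (nat \<Rightarrow> nat) \<Rightarrow> nat \<Rightarrow> nat \<Rightarrow> nat \<Rightarrow> bool" where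
  "is_lca V r par w a b \<longleftrightarrow> w \<in> V \<and> tree_anc r par w a \<and> tree_anc r par w b \<and>
     (\<forall>w' \<in> V. tree_anc r par w' a \<and> tree_anc r par w' b \<longrightarrow> tree_anc r par w' w)"

definition hst_tree :: "real \<Rightarrow> nat set \<Rightarrow> nat \<Rightarrow> (nat \<Rightarrow> nat) \<Rightarrow> (nat \<Rightarrow> real) \<Rightarrow> bool" where
  "hst_tree \<mu> V r par \<phi> \<longleftrightarrow>
     finite V \<and> r \<in> V \<and>
     (\<exists>dep :: nat \<Rightarrow> nat. dep r = 0 \<and>
        (\<forall>v \<in> V - {r}. par v \<in> V \<and> dep v = Suc (dep (par v)))) \<and>
     (\<forall>v \<in> V. \<phi> v \<ge> 0 \<and> (\<phi> v = 0 \<longleftrightarrow> tree_leaf V r par v)) \<and>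
     (\<forall>v \<in> V - {r}. \<phi> v \<le> \<phi> (par v) / \<mu>)"

definition hst_metric :: "point set \<Rightarrow> (point \<Rightarrow> point \<Rightarrow> real) \<Rightarrow> bool" where
  "hst_metric L d \<longleftrightarrow> L = {} \<or>
     (\<exists>\<mu> \<ge> 1. \<exists>V r par \<phi> (leaf :: point \<Rightarrow> nat).
        hst_tree \<mu> V r par \<phi> \<and> bij_betw leaf L {v. tree_leaf V r par v} \<and>
        (\<forall>x \<in> L. \<forall>y \<in> L. \<exists>w. is_lca V r par w (leaf x) (leaf y) \<and> d x y = \<phi> w))"

text \<open>A deterministic online embedding is a map from prefixes sigma_1..sigma_t of the
  update sequence to the metric d_t; online-ness is built in.\<close>
type_synonym embedding = "update list \<Rightarrow> point \<Rightarrow> point \<Rightarrow> real"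

definition det_monotone_embedding :: "nat \<Rightarrow> embedding \<Rightarrow> bool" where
  "det_monotone_embedding D A \<longleftrightarrow>
     (\<forall>\<sigma>. valid_seq D \<sigma> \<longrightarrow>
        (\<forall>t \<le> length \<sigma>.
           hst_metric (alive (take t \<sigma>)) (A (take t \<sigma>)) \<and>
           (\<forall>u \<in> alive (take t \<sigma>). \<forall>v \<in> alive (take t \<sigma>).
               A (take t \<sigma>) u v \<ge> linf_dist D u v)) \<and>
        (\<forall>t. 1 \<le> t \<and> t \<le> length \<sigma> \<longrightarrow>
           (\<forall>u \<in> alive (take (t - 1) \<sigma>) \<inter> alive (take t \<sigma>).
            \<forall>v \<in> alive (take (t - 1) \<sigma>) \<inter> alive (take t \<sigma>).
               A (take t \<sigma>) u v \<le> A (take (t - 1) \<sigma>) u v)))"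

definition prob_monotone_embedding :: "nat \<Rightarrow> embedding measure \<Rightarrow> bool" where
  "prob_monotone_embedding D M \<longleftrightarrow>
     prob_space M \<and> (\<forall>A \<in> space M. det_monotone_embedding D A) \<and>
     (\<forall>s u v. (\<lambda>A. A s u v) \<in> borel_measurable M)"

end

theory Submission
  imports Defs
begin

text \<open>
  At every scale \<open>2\<^sup>i\<close> overlay a grid with side \<open>2\<^sup>i\<close>, all grids shifted by one uniform
  \<open>U \<in> [0, 1]\<close> (in units of the side), and give each alive point a home cell; two points are separated
  at scale \<open>i\<close> if their homes differ, and their distance is the supremum of \<open>6 \<cdot> 2\<^sup>i\<close> over the scales
  separating them. An ultrametric results because having equal homes is an equivalence relation.

  When \<open>x\<close> arrives and no alive point is at distance in \<open>(2\<^sup>i, 4 \<cdot> 2\<^sup>i]\<close> from it, the points within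
  \<open>2\<^sup>i\<close> of \<open>x\<close> form whole clusters far from everything else, so all of them are moved to the cell of
  \<open>x\<close>; this only merges clusters and re-centres them, so that they cannot drift. Otherwise scale \<open>i\<close> is
  relevant for \<open>x\<close>, and \<open>x\<close> takes the home of the alive points in its own cell, if any. Each alive
  point makes two scales relevant, so a pair is separated only at scales below its distance, or at one
  of at most \<open>2l\<close> relevant scales, and there only if its grid cells differ, which has probability
  \<open>O(D d(u, v) / 2\<^sup>i)\<close>. Hence every relevant scale contributes \<open>O(D d(u, v))\<close> to the expectation.
\<close>

section \<open>Finite ultrametrics are HST metrics\<close>

lemma tree_anc_refl: "tree_anc r par v v"
  unfolding tree_anc_def by (rule exI[of _ 0]) simp

lemma tree_anc_step:
  assumes "v \<noteq> r" "tree_anc r par a (par v)"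
  shows "tree_anc r par a v"
proof -
  obtain k where k: "(par ^^ k) (par v) = a" "\<forall>j<k. (par ^^ j) (par v) \<noteq> r"
    using assms(2) unfolding tree_anc_def by blast
  have "(par ^^ j) v \<noteq> r" if "j < Suc k" for j
    using that assms(1) k(2) by (cases j) (auto simp: funpow_swap1)
  then show ?thesis
    unfolding tree_anc_def using k(1) by (intro exI[of _ "Suc k"]) (auto simp: funpow_swap1)
qed

lemma tree_anc_unfold:
  assumes "tree_anc r par a v"
  shows "a = v \<or> (v \<noteq> r \<and> tree_anc r par a (par v))"
proof -
  obtain k where k: "(par ^^ k) v = a" "\<forall>j<k. (par ^^ j) v \<noteq> r"
    using assms unfolding tree_anc_def by blast
  show ?thesis
  proof (cases k)
    case 0
    then show ?thesis using k by simp
  next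
    case (Suc m)
    have "v \<noteq> r" using k(2) Suc by force
    moreover have "(par ^^ j) (par v) \<noteq> r" if "j < m" for j
      using k(2) Suc that by (metis Suc_less_eq comp_apply funpow_Suc_right)
    moreover have "(par ^^ m) (par v) = a"
      using k(1) Suc by (simp add: funpow_swap1)
    ultimately show ?thesis unfolding tree_anc_def by blast
  qed
qed

text \<open>The balls of an ultrametric form a laminar family. Ordered by inclusion they are the
  nodes of a tree with \<open>\<mu> = 1\<close>: the weight of a ball is its diameter, the leaves
  are the singletons, and the least common ancestor of \<open>x\<close> and \<open>y\<close> is
  \<open>ball x (d x y)\<close>.\<close>

theorem ultrametric_imp_hst_metric:
  fixes d :: "point \<Rightarrow> point \<Rightarrow> real"
  assumes fin: "finite L"
    and refl: "\<And>x. x \<in> L \<Longrightarrow> d x x = 0"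
    and pos: "\<And>x y. x \<in> L \<Longrightarrow> y \<in> L \<Longrightarrow> x \<noteq> y \<Longrightarrow> d x y > 0"
    and sym: "\<And>x y. x \<in> L \<Longrightarrow> y \<in> L \<Longrightarrow> d x y = d y x"
    and ultra: "\<And>x y z. x \<in> L \<Longrightarrow> y \<in> L \<Longrightarrow> z \<in> L \<Longrightarrow> d x z \<le> max (d x y) (d y z)"
  shows "hst_metric L d"
proof (cases "L = {}")
  case True
  then show ?thesis by (simp add: hst_metric_def)
next
  case False
  define ball where "ball x r = {z \<in> L. d x z \<le> r}" for x r
  \<comment> \<open>Only attained distances serve as radii, so the family is finite and each radius
    is the diameter of its ball.\<close>
  define \<V> where "\<V> = (\<lambda>(x, y). ball x (d x y)) ` (L \<times> L)"
  have finV: "finite \<V>" using fin by (simp add: \<V>_def)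
  have \<V>I: "ball x (d x y) \<in> \<V>" if "x \<in> L" "y \<in> L" for x y
    using that by (force simp: \<V>_def)
  have \<V>E: "\<exists>x\<in>L. \<exists>y\<in>L. S = ball x (d x y)" if "S \<in> \<V>" for S
    using that by (auto simp: \<V>_def)
  have d0: "d x y \<ge> 0" if "x \<in> L" "y \<in> L" for x y
    using pos[OF that] refl[OF that(1)] by (cases "x = y") auto
  have ball_eq: "ball y r = ball x r" if "x \<in> L" "y \<in> ball x r" for x y r
    using that ultra[of x y] ultra[of y x] sym[of x y]
    by (fastforce simp: ball_def)
  have ball_self: "x \<in> ball x (d x y)" "y \<in> ball x (d x y)" if "x \<in> L" "y \<in> L" for x y
    using that refl d0 by (auto simp: ball_def)
  have Vsub: "S \<subseteq> L" if "S \<in> \<V>" for S using \<V>E[OF that] by (auto simp: ball_def)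
  have Vne: "S \<noteq> {}" if "S \<in> \<V>" for S using \<V>E[OF that] ball_self by blast
  \<comment> \<open>Both balls can be re-centred at the common point \<open>z\<close>, and then
    their radii are comparable.\<close>
  have laminar: "S \<subseteq> T \<or> T \<subseteq> S" if ST: "S \<in> \<V>" "T \<in> \<V>" "z \<in> S" "z \<in> T" for S T z
  proof -
    obtain x y x' y' where *: "x \<in> L" "y \<in> L" "S = ball x (d x y)" "x' \<in> L" "y' \<in> L" "T = ball x' (d x' y')"
      using \<V>E ST by metis
    have "S = ball z (d x y)" "T = ball z (d x' y')"
      using ball_eq * ST by metis+
    then show ?thesis by (auto simp: ball_def)
  qed
  have sing: "ball x (d x x) = {x}" if "x \<in> L" for x
    unfolding ball_def using that refl pos[OF that] by (auto simp: not_less[symmetric])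
  have singV: "{x} \<in> \<V>" if "x \<in> L" for x
    using \<V>I[OF that that] sing[OF that] by simp
  have rootV: "L \<in> \<V>"
  proof -
    obtain x where x: "x \<in> L" using False by blast
    have "Max (d x ` L) \<in> d x ` L" using fin x by (intro Max_in) auto
    then obtain y where "y \<in> L" "Max (d x ` L) = d x y" by auto
    moreover have "d x z \<le> Max (d x ` L)" if "z \<in> L" for z using fin that by simp
    ultimately have y: "y \<in> L" "\<And>z. z \<in> L \<Longrightarrow> d x z \<le> d x y" by auto
    have "ball x (d x y) = L" using y by (auto simp: ball_def)
    then show ?thesis using \<V>I[OF x y(1)] by simp
  qed
  \<comment> \<open>\<open>P S T\<close> makes \<open>T\<close> the parent of \<open>S\<close>. Such
    a \<open>T\<close> exists because the members above \<open>S\<close> share a point and hence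
    form a chain.\<close>
  define P where "P S T \<longleftrightarrow> T \<in> \<V> \<and> S \<subset> T \<and> (\<forall>T'\<in>\<V>. S \<subset> T' \<longrightarrow> T \<subseteq> T')" for S T
  have Pex: "\<exists>T. P S T" if "S \<in> \<V>" "S \<noteq> L" for S
  proof -
    have "L \<in> {T \<in> \<V>. S \<subset> T}" using that Vsub rootV by auto
    then obtain T where T: "T \<in> \<V>" "S \<subset> T" "\<And>T'. T' \<in> \<V> \<Longrightarrow> S \<subset> T' \<Longrightarrow> T' \<subseteq> T \<Longrightarrow> T = T'"
      using finite_has_minimal[of "{T \<in> \<V>. S \<subset> T}"] finV by (metis (no_types, lifting) empty_iff finite_subset mem_Collect_eq subsetI)
    have "S \<noteq> {}" using Vne that by blast
    then obtain z where "z \<in> S" by blast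
    have "T \<subseteq> T'" if "T' \<in> \<V>" "S \<subset> T'" for T'
      using laminar[of T T' z] T that \<open>z \<in> S\<close> by blast
    then show ?thesis using T unfolding P_def by blast
  qed
  define pS where "pS S = (SOME T. P S T)" for S
  have pS: "P S (pS S)" if "S \<in> \<V>" "S \<noteq> L" for S
    unfolding pS_def using Pex[OF that] by (rule someI_ex)
  have Puniq: "T = T'" if "P S T" "P S T'" for S T T'
    using that unfolding P_def by blast
  \<comment> \<open>Tree nodes have type \<open>nat\<close>, so the balls are numbered;
    \<open>par\<close> and \<open>\<phi>\<close> reach the ball behind a number through
    \<open>dec\<close>.\<close>
  obtain enc :: "point set \<Rightarrow> nat" where enc: "inj_on enc \<V>"
    using finite_imp_inj_to_nat_seg[OF finV] by blast
  define dec where "dec = inv_into \<V> enc"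
  have dec: "dec (enc S) = S" if "S \<in> \<V>" for S
    unfolding dec_def using enc that by simp
  define V where "V = enc ` \<V>"
  define r where "r = enc L"
  define par where "par n = enc (pS (dec n))" for n
  define \<phi> where "\<phi> n = Max ((\<lambda>(x, y). d x y) ` (dec n \<times> dec n))" for n
  have encr: "enc S = r \<longleftrightarrow> S = L" if "S \<in> \<V>" for S
    unfolding r_def using enc that rootV by (auto dest: inj_onD)
  have parenc: "par (enc S) = enc (pS S)" if "S \<in> \<V>" for S
    by (simp add: par_def dec that)
  have pSV: "pS S \<in> \<V>" "S \<subset> pS S" if "S \<in> \<V>" "S \<noteq> L" for S
    using pS[OF that] by (auto simp: P_def)
  have finS: "finite S" if "S \<in> \<V>" for S using Vsub[OF that] fin finite_subset by blast
  \<comment> \<open>Induction up the chain of parents: \<open>card (L - S)\<close> drops from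
    \<open>S\<close> to \<open>pS S\<close>. The converse \<open>anc_down\<close> uses the same
    measure.\<close>
  have anc_up: "S \<subseteq> T" if "S \<in> \<V>" "T \<in> \<V>" "tree_anc r par (enc T) (enc S)" for S T
    using that
  proof (induction "card (L - S)" arbitrary: S rule: less_induct)
    case less
    consider "enc T = enc S" | "enc S \<noteq> r" "tree_anc r par (enc T) (par (enc S))"
      using tree_anc_unfold[OF less.prems(3)] by blast
    then show ?case
    proof cases
      case 1
      then show ?thesis using enc less.prems by (auto dest: inj_onD)
    next
      case 2
      have S: "S \<noteq> L" using 2 encr less.prems by blast
      note p = pSV[OF less.prems(1) S]
      have "card (L - pS S) < card (L - S)"
        using p Vsub[OF p(1)] fin by (intro psubset_card_mono) auto
      then have "pS S \<subseteq> T"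
        using less.hyps[of "pS S"] p less.prems 2 parenc[OF less.prems(1)] by simp
      then show ?thesis using p by blast
    qed
  qed
  have anc_down: "tree_anc r par (enc T) (enc S)" if "S \<in> \<V>" "T \<in> \<V>" "S \<subseteq> T" for S T
    using that
  proof (induction "card (L - S)" arbitrary: S rule: less_induct)
    case less
    show ?case
    proof (cases "S = T")
      case True
      then show ?thesis by (simp add: tree_anc_refl)
    next
      case ST: False
      have S: "S \<noteq> L" using ST less.prems Vsub by blast
      note p = pSV[OF less.prems(1) S]
      have "card (L - pS S) < card (L - S)"
        using p Vsub[OF p(1)] fin by (intro psubset_card_mono) auto
      moreover have "pS S \<subseteq> T"
        using pS[OF less.prems(1) S] ST less.prems unfolding P_def by blast
      ultimately have "tree_anc r par (enc T) (enc (pS S))"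
        using less.hyps p less.prems by blast
      then show ?thesis
        using tree_anc_step[of "enc S" r par "enc T"] encr S less.prems(1) parenc by simp
    qed
  qed
  have leaf_iff: "tree_leaf V r par (enc S) \<longleftrightarrow> (\<exists>x. S = {x})" if S: "S \<in> \<V>" for S
  proof
    assume lf: "tree_leaf V r par (enc S)"
    obtain x where x: "x \<in> S" using Vne S by blast
    show "\<exists>x. S = {x}"
    proof (rule ccontr)
      assume "\<nexists>x. S = {x}"
      \<comment> \<open>A maximal member that contains \<open>x\<close> and lies strictly inside
        \<open>S\<close> has \<open>S\<close> as its parent, so \<open>S\<close> is no leaf.\<close>
      then have "{x} \<in> {T \<in> \<V>. x \<in> T \<and> T \<subset> S}" using x singV Vsub S by blast
      then obtain T where T: "T \<in> \<V>" "x \<in> T" "T \<subset> S"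
          "\<And>T'. T' \<in> \<V> \<Longrightarrow> x \<in> T' \<Longrightarrow> T' \<subset> S \<Longrightarrow> T \<subseteq> T' \<Longrightarrow> T = T'"
        using finite_has_maximal[of "{T \<in> \<V>. x \<in> T \<and> T \<subset> S}"] finV
        by (metis (no_types, lifting) empty_iff finite_subset mem_Collect_eq subsetI)
      have TL: "T \<noteq> L" using T(3) Vsub[OF S] by blast
      have "S \<subseteq> T'" if "T' \<in> \<V>" "T \<subset> T'" for T'
        using laminar[of S T' x] T(2) T(4)[of T'] x that S by blast
      then have "P T S" unfolding P_def using T S by blast
      then have "pS T = S" using Puniq pS[OF T(1) TL] by blast
      then have "enc T \<in> V - {r}" "par (enc T) = enc S"
        using T(1) TL encr parenc by (auto simp: V_def)
      then show False using lf unfolding tree_leaf_def by blast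
    qed
  next
    assume "\<exists>x. S = {x}"
    then obtain x where x: "S = {x}" by blast
    have False if "u \<in> V - {r}" "par u = enc S" for u
    proof -
      obtain T where T: "T \<in> \<V>" "u = enc T" "T \<noteq> L" using \<open>u \<in> V - {r}\<close> encr by (auto simp: V_def)
      then have "pS T = S"
        using that(2) parenc[OF T(1)] pSV[OF T(1,3)] enc S by (auto dest: inj_onD)
      then have "T \<subset> {x}" using pSV(2)[OF T(1,3)] x by simp
      then show False using Vne[OF T(1)] by auto
    qed
    then show "tree_leaf V r par (enc S)" unfolding tree_leaf_def using S by (auto simp: V_def)
  qed
  have \<phi>_ball: "\<phi> (enc (ball x (d x y))) = d x y" if xy: "x \<in> L" "y \<in> L" for x y
  proof -
    let ?S = "ball x (d x y)"
    have le: "d z w \<le> d x y" if "z \<in> ?S" "w \<in> ?S" for z w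
      using that ultra[of z x w] sym[of z x] xy by (auto simp: ball_def)
    show ?thesis
      unfolding \<phi>_def dec[OF \<V>I[OF xy]]
      using ball_self[OF xy] finS[OF \<V>I[OF xy]] le
      by (intro Max_eqI) (auto intro!: image_eqI[of _ _ "(x, y)"])
  qed
  have \<phi>_mono: "\<phi> (enc S) \<le> \<phi> (enc T)" if "S \<in> \<V>" "T \<in> \<V>" "S \<subseteq> T" for S T
    unfolding \<phi>_def dec[OF that(1)] dec[OF that(2)]
    using that Vne[OF that(1)] finS[OF that(2)] by (intro Max_mono) auto
  have "hst_tree 1 V r par \<phi>"
    unfolding hst_tree_def
  proof (intro conjI ballI)
    show "finite V" "r \<in> V" using finV rootV by (auto simp: V_def r_def)
    \<comment> \<open>The depth counts the members strictly above a ball. These are its parent and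
      the members strictly above the parent.\<close>
    define dep where "dep n = card {T \<in> \<V>. dec n \<subset> T}" for n
    have "{T \<in> \<V>. L \<subset> T} = {}" using Vsub by blast
    then have dep_r: "dep r = 0" unfolding dep_def r_def dec[OF rootV] by (simp only: card.empty)
    have "par v \<in> V \<and> dep v = Suc (dep (par v))" if v: "v \<in> V - {r}" for v
    proof -
      obtain S where S: "S \<in> \<V>" "v = enc S" "S \<noteq> L" using v encr by (auto simp: V_def)
      note p = pSV[OF S(1,3)]
      have "{T \<in> \<V>. S \<subset> T} = insert (pS S) {T \<in> \<V>. pS S \<subset> T}"
        using pS[OF S(1,3)] unfolding P_def by blast
      then have "card {T \<in> \<V>. S \<subset> T} = Suc (card {T \<in> \<V>. pS S \<subset> T})"
        using finV by simp
      then show ?thesis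
        using S p parenc[OF S(1)] by (simp add: dep_def dec V_def)
    qed
    then show "\<exists>dep. dep r = 0 \<and> (\<forall>v\<in>V - {r}. par v \<in> V \<and> dep v = Suc (dep (par v)))"
      using dep_r by blast
    show "\<phi> v \<ge> 0" "\<phi> v = 0 \<longleftrightarrow> tree_leaf V r par v" if "v \<in> V" for v
    proof -
      obtain S where S: "S \<in> \<V>" "v = enc S" using \<open>v \<in> V\<close> by (auto simp: V_def)
      obtain x y where xy: "x \<in> L" "y \<in> L" "S = ball x (d x y)" using \<V>E S by metis
      have \<phi>v: "\<phi> v = d x y" using \<phi>_ball xy S by simp
      then show "\<phi> v \<ge> 0" using d0 xy by simp
      have "d x y = 0 \<longleftrightarrow> (\<exists>z. S = {z})"
      proof
        assume "d x y = 0"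
        then have "x = y" using pos[OF xy(1,2)] by force
        then show "\<exists>z. S = {z}" using xy sing by blast
      next
        assume "\<exists>z. S = {z}"
        then have "x = y" using ball_self[OF xy(1,2), folded xy(3)] by auto
        then show "d x y = 0" using refl xy by simp
      qed
      then show "\<phi> v = 0 \<longleftrightarrow> tree_leaf V r par v" using leaf_iff[OF S(1)] S(2) \<phi>v by simp
    qed
    show "\<phi> v \<le> \<phi> (par v) / 1" if "v \<in> V - {r}" for v
    proof -
      obtain S where S: "S \<in> \<V>" "v = enc S" "S \<noteq> L" using \<open>v \<in> V - {r}\<close> encr by (auto simp: V_def)
      show ?thesis using \<phi>_mono[of S "pS S"] pSV[OF S(1,3)] S parenc by auto
    qed
  qed
  moreover have "bij_betw (\<lambda>x. enc {x}) L {v. tree_leaf V r par v}"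
  proof (rule bij_betw_imageI)
    show "inj_on (\<lambda>x. enc {x}) L"
      using enc singV by (auto simp: inj_on_def)
    show "(\<lambda>x. enc {x}) ` L = {v. tree_leaf V r par v}"
    proof (intro equalityI subsetI)
      fix v assume "v \<in> (\<lambda>x. enc {x}) ` L"
      then show "v \<in> {v. tree_leaf V r par v}" using leaf_iff singV by auto
    next
      fix v assume v: "v \<in> {v. tree_leaf V r par v}"
      then obtain S where S: "S \<in> \<V>" "v = enc S" by (auto simp: tree_leaf_def V_def)
      then obtain x where "S = {x}" using v leaf_iff by auto
      then show "v \<in> (\<lambda>x. enc {x}) ` L" using S Vsub by blast
    qed
  qed
  moreover have "is_lca V r par (enc (ball x (d x y))) (enc {x}) (enc {y}) \<and> d x y = \<phi> (enc (ball x (d x y)))"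
    if xy: "x \<in> L" "y \<in> L" for x y
  proof -
    let ?B = "ball x (d x y)"
    have B: "?B \<in> \<V>" using \<V>I xy .
    \<comment> \<open>Re-centred at \<open>x\<close>, a member containing \<open>y\<close> has
      radius at least \<open>d x y\<close>.\<close>
    have sub: "?B \<subseteq> T" if T: "T \<in> \<V>" "x \<in> T" "y \<in> T" for T
    proof -
      obtain a b where ab: "a \<in> L" "b \<in> L" "T = ball a (d a b)" using \<V>E T by metis
      then have "T = ball x (d a b)" using ball_eq T by metis
      then show ?thesis using T by (auto simp: ball_def)
    qed
    have "tree_anc r par w (enc ?B)"
      if w: "w \<in> V" "tree_anc r par w (enc {x})" "tree_anc r par w (enc {y})" for w
    proof -
      obtain T where T: "T \<in> \<V>" "w = enc T" using w by (auto simp: V_def)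
      have "x \<in> T" "y \<in> T" using anc_up[OF singV] T w xy by blast+
      then show ?thesis using anc_down[OF B T(1)] sub T by blast
    qed
    then show ?thesis
      unfolding is_lca_def using B anc_down[OF singV B] ball_self[OF xy] xy \<phi>_ball[OF xy]
      by (auto simp: V_def)
  qed
  ultimately show ?thesis
    unfolding hst_metric_def
    by (intro disjI2 exI[of _ 1] exI[of _ V] exI[of _ r] exI[of _ par] exI[of _ \<phi>]
        exI[of _ "\<lambda>x. enc {x}"]) (meson order_refl)
qed

section \<open>The maximum distance\<close>

lemma linf_dist_le_iff: "linf_dist D u v \<le> r \<longleftrightarrow> 0 \<le> r \<and> (\<forall>k<D. \<bar>u ! k - v ! k\<bar> \<le> r)"
  unfolding linf_dist_def by (subst Max_le_iff) auto

lemma linf_dist_nonneg: "0 \<le> linf_dist D u v"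
  and linf_dist_coord: "k < D \<Longrightarrow> \<bar>u ! k - v ! k\<bar> \<le> linf_dist D u v"
  using linf_dist_le_iff[of D u v "linf_dist D u v"] by auto

lemma linf_dist_self: "linf_dist D u u = 0"
  using linf_dist_le_iff[of D u u 0] linf_dist_nonneg[of D u u] by simp

lemma linf_dist_commute: "linf_dist D u v = linf_dist D v u"
  by (simp add: linf_dist_def abs_minus_commute)

lemma linf_dist_triangle: "linf_dist D u w \<le> linf_dist D u v + linf_dist D v w"
  unfolding linf_dist_le_iff[of D u w]
  using linf_dist_nonneg[of D u v] linf_dist_nonneg[of D v w]
    linf_dist_coord[of _ D u v] linf_dist_coord[of _ D v w]
  by fastforce

lemma linf_dist_pos:
  assumes "length u = D" "length v = D" "u \<noteq> v"
  shows "0 < linf_dist D u v"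
proof -
  obtain k where "k < D" "u ! k \<noteq> v ! k" using assms nth_equalityI by metis
  then show ?thesis using linf_dist_coord[of k D u v] by auto
qed

section \<open>Alive sets\<close>

lemma alive_Nil [simp]: "alive [] = {}"
  by (simp add: alive_def)

lemma alive_snoc [simp]:
  "alive (\<sigma> @ [e]) = (if snd e then insert (fst e) (alive \<sigma>) else alive \<sigma> - {fst e})"
  by (auto simp: alive_def split: prod.split)

lemma alive_subset: "alive \<sigma> \<subseteq> fst ` set \<sigma>"
  by (induction \<sigma> rule: rev_induct) auto

lemma finite_alive: "finite (alive \<sigma>)"
  by (rule finite_subset[OF alive_subset]) simp

lemma valid_seq_snoc: "valid_seq D (\<sigma> @ [e]) \<longleftrightarrow> valid_seq D \<sigma> \<and> length (fst e) = D"
  by (auto simp: valid_seq_def split: prod.splits)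

lemma length_alive: "valid_seq D \<sigma> \<Longrightarrow> u \<in> alive \<sigma> \<Longrightarrow> length u = D"
  using alive_subset[of \<sigma>] by (fastforce simp: valid_seq_def)

lemma valid_seq_take: "valid_seq D \<sigma> \<Longrightarrow> valid_seq D (take t \<sigma>)"
  by (auto simp: valid_seq_def dest: in_set_takeD)

lemma width_take_le: "width (take t \<sigma>) \<le> width \<sigma>"
  unfolding width_def by (rule Max_mono) (auto simp: min_def intro!: image_eqI)

lemma card_alive_le_width: "card (alive \<sigma>) \<le> width \<sigma>"
  unfolding width_def by (rule Max_ge) (auto intro!: image_eqI[of _ _ "length \<sigma>"])

lemma width_snoc_ge: "width \<sigma> \<le> width (\<sigma> @ [e])"
  using width_take_le[of "length \<sigma>" "\<sigma> @ [e]"] by simp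

section \<open>Home cells at a single scale\<close>

definition cell :: "real \<Rightarrow> real \<Rightarrow> point \<Rightarrow> int list" where
  "cell s U x = map (\<lambda>a. \<lfloor>a / s + U\<rfloor>) x"

text \<open>The factor 4 is 1 + 3: points with equal homes will be at most \<open>3 * s\<close>
  apart, so if no point of \<open>L\<close> lies in this range, a cluster that meets the ball of
  radius \<open>s\<close> around \<open>x\<close> stays inside that ball.\<close>

definition relevant :: "nat \<Rightarrow> real \<Rightarrow> point set \<Rightarrow> point \<Rightarrow> bool" where
  "relevant D s L x \<longleftrightarrow> (\<exists>w\<in>L. s < linf_dist D x w \<and> linf_dist D x w \<le> 4 * s)"

text \<open>\<open>g\<close> gives the grid cells and \<open>h\<close> the homes before
  \<open>x\<close> arrives. For homes built from \<open>cell s U\<close>, alive points of one cell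
  share a home, so every choice by \<open>SOME\<close> leads to the same value.\<close>

definition settle :: "nat \<Rightarrow> real \<Rightarrow> (point \<Rightarrow> int list) \<Rightarrow> point set \<Rightarrow> point \<Rightarrow>
    (point \<Rightarrow> int list) \<Rightarrow> point \<Rightarrow> int list" where
  "settle D s g L x h =
     (if relevant D s L x
      then h(x := if \<exists>u\<in>L. g u = g x then h (SOME u. u \<in> L \<and> g u = g x) else g x)
      else (\<lambda>y. if y = x \<or> y \<in> L \<and> linf_dist D x y \<le> s then g x else h y))"

text \<open>The update sequence is read backwards: the head of the list is the latest update.\<close>
primrec home_rev :: "nat \<Rightarrow> real \<Rightarrow> (point \<Rightarrow> int list) \<Rightarrow> update list \<Rightarrow> point \<Rightarrow> int list" where
  "home_rev D s g [] = g"
| "home_rev D s g (e # es) =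
     (if snd e \<and> fst e \<notin> alive (rev es)
      then settle D s g (alive (rev es)) (fst e) (home_rev D s g es)
      else home_rev D s g es)"

definition home :: "nat \<Rightarrow> real \<Rightarrow> (point \<Rightarrow> int list) \<Rightarrow> update list \<Rightarrow> point \<Rightarrow> int list" where
  "home D s g \<sigma> = home_rev D s g (rev \<sigma>)"

text \<open>A departed point keeps its old value, which \<open>settle\<close> overwrites if the
  point arrives again; the arrival of a point that is already alive changes nothing.\<close>

lemma home_snoc:
  "home D s g (\<sigma> @ [e]) =
     (if snd e \<and> fst e \<notin> alive \<sigma> then settle D s g (alive \<sigma>) (fst e) (home D s g \<sigma>)
      else home D s g \<sigma>)"
  by (simp add: home_def)

text \<open>Homes depend on the shift only through the cells of the finitely many points in the
  sequence; measurability in \<open>U\<close> rests on this.\<close>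

lemma home_cong:
  assumes "\<And>x. x \<in> fst ` set \<sigma> \<Longrightarrow> g x = g' x" "u \<in> alive \<sigma>"
  shows "home D s g \<sigma> u = home D s g' \<sigma> u"
  using assms
proof (induction \<sigma> arbitrary: u rule: rev_induct)
  case Nil
  then show ?case by simp
next
  case (snoc e \<sigma>)
  have IH: "home D s g \<sigma> v = home D s g' \<sigma> v" if "v \<in> alive \<sigma>" for v
    using snoc.IH[OF _ that] snoc.prems(1) by simp
  have gL: "g v = g' v" if "v \<in> insert (fst e) (alive \<sigma>)" for v
    using alive_subset[of \<sigma>] that by (intro snoc.prems(1)) auto
  show ?case
  proof (cases "snd e \<and> fst e \<notin> alive \<sigma>")
    case False
    then show ?thesis using snoc.prems(2) IH by (auto simp: home_snoc split: if_splits)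
  next
    case True
    let ?x = "fst e" and ?L = "alive \<sigma>"
    \<comment> \<open>The two predicates are equal, so \<open>SOME\<close> picks the same point for
      \<open>g\<close> and \<open>g'\<close>.\<close>
    have eq: "(\<lambda>v. v \<in> ?L \<and> g v = g ?x) = (\<lambda>v. v \<in> ?L \<and> g' v = g' ?x)" using gL by auto
    have "(SOME v. v \<in> ?L \<and> g v = g ?x) \<in> ?L" if "\<exists>v\<in>?L. g v = g ?x"
      using someI_ex[of "\<lambda>v. v \<in> ?L \<and> g v = g ?x"] that by blast
    moreover have "(\<exists>v\<in>?L. g v = g ?x) \<longleftrightarrow> (\<exists>v\<in>?L. g' v = g' ?x)" using gL by auto
    ultimately show ?thesis
      using True snoc.prems(2) IH gL[of ?x] eq by (auto simp: home_snoc settle_def)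
  qed
qed

section \<open>Cells, clusters and distances\<close>

lemma cell_nth: "k < length x \<Longrightarrow> cell s U x ! k = \<lfloor>x ! k / s + U\<rfloor>"
  by (simp add: cell_def)

lemma cell_diff_le_1:
  assumes "s > 0" "length x = D" "length y = D" "k < D" "linf_dist D x y \<le> s"
  shows "\<bar>cell s U x ! k - cell s U y ! k\<bar> \<le> 1"
proof -
  have "\<bar>x ! k - y ! k\<bar> \<le> s" using linf_dist_coord[OF assms(4), of x y] assms(5) by simp
  then have "\<bar>x ! k / s - y ! k / s\<bar> \<le> 1"
    using assms(1) by (simp add: diff_divide_distrib[symmetric] abs_divide)
  then show ?thesis using assms by (simp add: cell_nth) linarith
qed

text \<open>Reals whose floors differ by at most \<open>m\<close> differ by less than
  \<open>m + 1\<close>; this is applied to each coordinate divided by \<open>s\<close>.\<close>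

lemma linf_dist_le_of_cell:
  assumes "s > 0" "length x = D" "length y = D" "m \<ge> 0"
    "\<And>k. k < D \<Longrightarrow> \<bar>cell s U x ! k - cell s U y ! k\<bar> \<le> m"
  shows "linf_dist D x y \<le> (real_of_int m + 1) * s"
  unfolding linf_dist_le_iff
proof (intro conjI allI impI)
  show "0 \<le> (real_of_int m + 1) * s" using assms by simp
  fix k assume k: "k < D"
  have "\<bar>x ! k / s - y ! k / s\<bar> \<le> real_of_int m + 1"
    using assms(5)[OF k] assms(2,3) k by (simp add: cell_nth) linarith
  then show "\<bar>x ! k - y ! k\<bar> \<le> (real_of_int m + 1) * s"
    using assms(1) by (simp add: diff_divide_distrib[symmetric] abs_divide divide_le_eq)
qed

text \<open>The second part confines every cluster to the block of cells around its home, which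
  prevents clusters from drifting.\<close>
lemma home_invariant:
  fixes U :: real
  assumes s: "s > 0" and "valid_seq D \<sigma>"
  defines "g \<equiv> cell s U"
  shows "(\<forall>u\<in>alive \<sigma>. \<forall>w\<in>alive \<sigma>. g u = g w \<longrightarrow> home D s g \<sigma> u = home D s g \<sigma> w) \<and>
         (\<forall>u\<in>alive \<sigma>. \<forall>k<D. \<bar>g u ! k - home D s g \<sigma> u ! k\<bar> \<le> 1)"
  using \<open>valid_seq D \<sigma>\<close>
proof (induction \<sigma> rule: rev_induct)
  case Nil
  then show ?case by simp
next
  case (snoc e \<sigma>)
  let ?x = "fst e" and ?L = "alive \<sigma>" and ?h = "home D s g \<sigma>" and ?h' = "home D s g (\<sigma> @ [e])"
  have val: "valid_seq D \<sigma>" and lx: "length ?x = D"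
    using snoc.prems by (simp_all add: valid_seq_snoc)
  have IH1: "?h u = ?h w" if "u \<in> ?L" "w \<in> ?L" "g u = g w" for u w
    using snoc.IH[OF val] that by blast
  have IH2: "\<bar>g u ! k - ?h u ! k\<bar> \<le> 1" if "u \<in> ?L" "k < D" for u k
    using snoc.IH[OF val] that by blast
  have len: "length u = D" if "u \<in> ?L" for u using length_alive[OF val that] .
  have alive_new: "alive (\<sigma> @ [e]) = insert ?x ?L" if "snd e" using that by simp
  consider "\<not> (snd e \<and> ?x \<notin> ?L)" | "snd e" "?x \<notin> ?L" "relevant D s ?L ?x"
    | "snd e" "?x \<notin> ?L" "\<not> relevant D s ?L ?x" by blast
  then show ?case
  proof cases
    case 1
    then have h': "?h' = ?h" and sub: "alive (\<sigma> @ [e]) \<subseteq> ?L" by (auto simp: home_snoc)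
    show ?thesis unfolding h' using IH1 IH2 sub by blast
  next
    case 2
    have h': "?h' u = ?h u" if "u \<in> ?L" for u using 2 that by (auto simp: home_snoc settle_def)
    show ?thesis
    proof (cases "\<exists>u\<in>?L. g u = g ?x")
      case True
      \<comment> \<open>Since \<open>z\<close> lies in the cell of \<open>?x\<close>, both parts of
        the invariant pass from \<open>z\<close> to \<open>?x\<close> along with the home.\<close>
      define z where "z = (SOME u. u \<in> ?L \<and> g u = g ?x)"
      have z: "z \<in> ?L" "g z = g ?x"
        using someI_ex[of "\<lambda>u. u \<in> ?L \<and> g u = g ?x"] True unfolding z_def by blast+
      have "?h' ?x = ?h z" using 2 True by (simp add: home_snoc settle_def z_def)
      then have "?h' u = ?h' w" if "u \<in> insert ?x ?L" "w \<in> insert ?x ?L" "g u = g w" for u w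
        using that h' z IH1[of u w] IH1[of z w] IH1[of u z] by auto
      moreover have "\<bar>g u ! k - ?h' u ! k\<bar> \<le> 1" if "u \<in> insert ?x ?L" "k < D" for u k
        using that h' z IH2[of u k] IH2[of z k] \<open>?h' ?x = ?h z\<close> by auto
      ultimately show ?thesis unfolding alive_new[OF 2(1)] by blast
    next
      case False
      have "?h' ?x = g ?x" using 2 False by (simp add: home_snoc settle_def)
      then have "?h' u = ?h' w" if "u \<in> insert ?x ?L" "w \<in> insert ?x ?L" "g u = g w" for u w
        using that h' False IH1[of u w] by force
      moreover have "\<bar>g u ! k - ?h' u ! k\<bar> \<le> 1" if "u \<in> insert ?x ?L" "k < D" for u k
        using that h' IH2[of u k] \<open>?h' ?x = g ?x\<close> by auto
      ultimately show ?thesis unfolding alive_new[OF 2(1)] by blast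
    qed
  next
    case 3
    have near: "linf_dist D ?x w \<le> s" if "w \<in> ?L" "linf_dist D ?x w \<le> 4 * s" for w
      using 3(3) that by (force simp: relevant_def)
    have h': "?h' y = (if y = ?x \<or> y \<in> ?L \<and> linf_dist D ?x y \<le> s then g ?x else ?h y)" for y
      using 3 by (simp add: home_snoc settle_def)
    \<comment> \<open>The moved points form whole cells: a cell-mate of a moved point is within
      \<open>2 * s\<close> of \<open>?x\<close>, and as no alive point has distance in the range
      from \<open>s\<close> to \<open>4 * s\<close>, it is within \<open>s\<close> and moves
      too.\<close>
    have trans: "w = ?x \<or> linf_dist D ?x w \<le> s"
      if "u \<in> insert ?x ?L" "w \<in> insert ?x ?L" "g u = g w" "u = ?x \<or> linf_dist D ?x u \<le> s" for u w
    proof -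
      have "length u = D" "length w = D" using that len lx by auto
      then have "linf_dist D u w \<le> s"
        using linf_dist_le_of_cell[OF s, of u D w 0 U] that(3) by (simp add: g_def)
      moreover have "linf_dist D ?x u \<le> s" using that(4) s by (auto simp: linf_dist_self)
      ultimately have "linf_dist D ?x w \<le> 4 * s"
        using linf_dist_triangle[of D ?x w u] s by simp
      then show ?thesis using near that(2) by blast
    qed
    have "?h' u = ?h' w" if "u \<in> insert ?x ?L" "w \<in> insert ?x ?L" "g u = g w" for u w
      using trans[of u w] trans[of w u] that IH1[of u w] h' by auto
    moreover have "\<bar>g u ! k - ?h' u ! k\<bar> \<le> 1" if "u \<in> insert ?x ?L" "k < D" for u k
    proof -
      \<comment> \<open>A moved point is within \<open>s\<close> of \<open>?x\<close>, so its cell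
        equals or touches the new home.\<close>
      have "\<bar>g u ! k - g ?x ! k\<bar> \<le> 1" if "u \<in> ?L" "linf_dist D ?x u \<le> s"
        using cell_diff_le_1[OF s len[OF that(1)] lx \<open>k < D\<close>] that(2)
        by (simp add: g_def linf_dist_commute)
      then show ?thesis using that IH2[of u k] h'[of u] by auto
    qed
    ultimately show ?thesis unfolding alive_new[OF 3(1)] by blast
  qed
qed

lemma home_eq_of_cell_eq:
  assumes "s > 0" "valid_seq D \<sigma>" "u \<in> alive \<sigma>" "w \<in> alive \<sigma>" "cell s U u = cell s U w"
  shows "home D s (cell s U) \<sigma> u = home D s (cell s U) \<sigma> w"
  using home_invariant[OF assms(1,2)] assms(3-) by blast

text \<open>In each coordinate both cells differ from the common home by at most 1, hence from each
  other by at most 2.\<close>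

lemma linf_dist_le_of_home_eq:
  assumes "s > 0" "valid_seq D \<sigma>" "u \<in> alive \<sigma>" "w \<in> alive \<sigma>"
    "home D s (cell s U) \<sigma> u = home D s (cell s U) \<sigma> w"
  shows "linf_dist D u w \<le> 3 * s"
proof -
  have "\<bar>cell s U u ! k - cell s U w ! k\<bar> \<le> 2" if "k < D" for k
  proof -
    have "\<bar>cell s U u ! k - home D s (cell s U) \<sigma> u ! k\<bar> \<le> 1"
         "\<bar>cell s U w ! k - home D s (cell s U) \<sigma> w ! k\<bar> \<le> 1"
      using home_invariant[OF assms(1,2)] assms(3,4) that by blast+
    then show ?thesis using assms(5) by simp
  qed
  then show ?thesis
    using linf_dist_le_of_cell[OF assms(1), of u D w 2 U] length_alive[OF assms(2)] assms(3,4) by simp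
qed

text \<open>The source of monotonicity. Homes of alive points change only when a point arrives at a
  scale that is not relevant for it. A cluster has diameter at most \<open>3 * s\<close>, so it then
  lies entirely within \<open>s\<close> of the newcomer or entirely beyond \<open>4 * s\<close>, and
  moves as a whole or not at all.\<close>

lemma home_eq_preserved:
  assumes "s > 0" "valid_seq D (\<sigma> @ [e])" "u \<in> alive \<sigma>" "w \<in> alive \<sigma>"
    "home D s (cell s U) \<sigma> u = home D s (cell s U) \<sigma> w"
  shows "home D s (cell s U) (\<sigma> @ [e]) u = home D s (cell s U) (\<sigma> @ [e]) w"
proof (cases "snd e \<and> fst e \<notin> alive \<sigma> \<and> \<not> relevant D s (alive \<sigma>) (fst e)")
  case False
  then show ?thesis using assms(3-) by (auto simp: home_snoc settle_def)
next
  case True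
  let ?x = "fst e"
  have val: "valid_seq D \<sigma>" using assms(2) by (simp add: valid_seq_snoc)
  have near: "linf_dist D ?x z \<le> s" if "z \<in> alive \<sigma>" "linf_dist D ?x z \<le> 4 * s" for z
    using True that by (force simp: relevant_def)
  have "linf_dist D u w \<le> 3 * s" using linf_dist_le_of_home_eq[OF assms(1) val assms(3-)] .
  then have "linf_dist D ?x u \<le> s \<longleftrightarrow> linf_dist D ?x w \<le> s"
    using near[OF assms(3)] near[OF assms(4)] linf_dist_triangle[of D ?x u w]
      linf_dist_triangle[of D ?x w u] linf_dist_commute[of D u w] by auto
  then show ?thesis using True assms(3-) by (auto simp: home_snoc settle_def)
qed

section \<open>The relevant scales of a pair\<close>

lemma powi_scales_subset:
  assumes "0 < (r::real)"
  obtains j :: int where "{i. 2 powi i < r \<and> r \<le> 4 * 2 powi i} \<subseteq> {j, j + 1}"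
proof -
  \<comment> \<open>The two inequalities say \<open>log 2 r - 2 \<le> i < log 2 r\<close>, a
    half-open interval of length 2.\<close>
  define j where "j = \<lceil>log 2 r\<rceil> - 2"
  have "i \<in> {j, j + 1}" if "2 powi i < r" "r \<le> 4 * 2 powi i" for i
  proof -
    have eq: "2 powi i = 2 powr (real_of_int i)" by (simp add: powr_real_of_int' powr_of_int)
    have "real_of_int i < log 2 r" using that(1) assms by (simp add: eq less_log_iff)
    moreover have "4 * 2 powr real_of_int i = 2 powr (real_of_int i + 2)" by (simp add: powr_add)
    then have "log 2 r \<le> real_of_int i + 2" using that(2) assms by (simp add: eq log_le_iff)
    ultimately have "\<lceil>log 2 r\<rceil> = i + 1 \<or> \<lceil>log 2 r\<rceil> = i + 2" by linarith
    then show ?thesis by (auto simp: j_def)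
  qed
  then show thesis using that[of j] by blast
qed

lemma card_powi_scales:
  assumes "0 < (r::real)"
  shows "finite {i::int. 2 powi i < r \<and> r \<le> 4 * 2 powi i}"
    "card {i::int. 2 powi i < r \<and> r \<le> 4 * 2 powi i} \<le> 2"
proof -
  obtain j where j: "{i. 2 powi i < r \<and> r \<le> 4 * 2 powi i} \<subseteq> {j, j + 1}"
    using powi_scales_subset[OF assms] .
  show "finite {i::int. 2 powi i < r \<and> r \<le> 4 * 2 powi i}" using finite_subset[OF j] by simp
  show "card {i::int. 2 powi i < r \<and> r \<le> 4 * 2 powi i} \<le> 2"
    using card_mono[OF _ j] by simp
qed

lemma card_relevant_scales:
  assumes "finite L" "x \<notin> L" "length x = D" "\<And>w. w \<in> L \<Longrightarrow> length w = D"
  shows "finite {i. relevant D (2 powi i) L x}" "card {i. relevant D (2 powi i) L x} \<le> 2 * card L"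
proof -
  let ?S = "\<lambda>w. {i::int. 2 powi i < linf_dist D x w \<and> linf_dist D x w \<le> 4 * 2 powi i}"
  have eq: "{i. relevant D (2 powi i) L x} = (\<Union>w\<in>L. ?S w)" by (auto simp: relevant_def)
  have pos: "0 < linf_dist D x w" if "w \<in> L" for w using assms that by (intro linf_dist_pos) auto
  show "finite {i. relevant D (2 powi i) L x}"
    unfolding eq using assms(1) card_powi_scales(1)[OF pos] by blast
  have "card (\<Union>w\<in>L. ?S w) \<le> (\<Sum>w\<in>L. card (?S w))" by (rule card_UN_le[OF assms(1)])
  also have "\<dots> \<le> (\<Sum>w\<in>L. 2)" by (intro sum_mono card_powi_scales(2) pos)
  finally show "card {i. relevant D (2 powi i) L x} \<le> 2 * card L" unfolding eq by simp
qed

text \<open>The set of scales does not depend on the shift \<open>U\<close>: it is determined by the arrival of the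
  later of the two points.\<close>
lemma home_neq_scales:
  assumes "valid_seq D \<sigma>" "u \<in> alive \<sigma>" "v \<in> alive \<sigma>"
  obtains R :: "int set" where "finite R" "card R \<le> 2 * width \<sigma>"
    "\<And>i U. home D (2 powi i) (cell (2 powi i) U) \<sigma> u \<noteq> home D (2 powi i) (cell (2 powi i) U) \<sigma> v
       \<Longrightarrow> 2 powi i < linf_dist D u v \<or> i \<in> R"
proof -
  have "\<exists>R::int set. finite R \<and> card R \<le> 2 * width \<sigma> \<and>
     (\<forall>i U. home D (2 powi i) (cell (2 powi i) U) \<sigma> u \<noteq> home D (2 powi i) (cell (2 powi i) U) \<sigma> v
       \<longrightarrow> 2 powi i < linf_dist D u v \<or> i \<in> R)"
    using assms
  proof (induction \<sigma> arbitrary: u v rule: rev_induct)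
    case Nil
    then show ?case by simp
  next
    case (snoc e \<sigma>)
    let ?x = "fst e" and ?L = "alive \<sigma>"
    let ?h = "\<lambda>\<sigma> i U. home D (2 powi i) (cell (2 powi i) U) \<sigma>"
    have val: "valid_seq D \<sigma>" and lx: "length ?x = D"
      using snoc.prems(1) by (simp_all add: valid_seq_snoc)
    \<comment> \<open>Equal homes stay equal, so the scales found before the update still suffice,
      and the width does not decrease.\<close>
    have old: "\<exists>R::int set. finite R \<and> card R \<le> 2 * width (\<sigma> @ [e]) \<and>
       (\<forall>i U. ?h (\<sigma> @ [e]) i U u \<noteq> ?h (\<sigma> @ [e]) i U v \<longrightarrow> 2 powi i < linf_dist D u v \<or> i \<in> R)"
      if "u \<in> ?L" "v \<in> ?L" for u v
    proof -
      obtain R :: "int set" where R: "finite R" "card R \<le> 2 * width \<sigma>"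
        "\<And>i U. ?h \<sigma> i U u \<noteq> ?h \<sigma> i U v \<Longrightarrow> 2 powi i < linf_dist D u v \<or> i \<in> R"
        using snoc.IH[OF val \<open>u \<in> ?L\<close> \<open>v \<in> ?L\<close>] by blast
      have "?h \<sigma> i U u \<noteq> ?h \<sigma> i U v" if "?h (\<sigma> @ [e]) i U u \<noteq> ?h (\<sigma> @ [e]) i U v" for i U
        using home_eq_preserved[OF _ snoc.prems(1) \<open>u \<in> ?L\<close> \<open>v \<in> ?L\<close>, of "2 powi i" U] that by auto
      then show ?thesis using R width_snoc_ge[of \<sigma> e] by (intro exI[of _ R]) force
    qed
    \<comment> \<open>At a scale that is not relevant, \<open>?x\<close> and every alive point
      within \<open>2 powi i\<close> of it receive the same home.\<close>
    have new: "\<exists>R::int set. finite R \<and> card R \<le> 2 * width (\<sigma> @ [e]) \<and>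
       (\<forall>i U. ?h (\<sigma> @ [e]) i U ?x \<noteq> ?h (\<sigma> @ [e]) i U v \<longrightarrow> 2 powi i < linf_dist D ?x v \<or> i \<in> R)"
      if "snd e" "?x \<notin> ?L" "v \<in> ?L" for v
    proof (intro exI conjI allI impI)
      let ?R = "{i. relevant D (2 powi i) ?L ?x}"
      note R = card_relevant_scales[OF finite_alive that(2) lx length_alive[OF val]]
      show "finite ?R" using R(1) .
      show "card ?R \<le> 2 * width (\<sigma> @ [e])"
        using R(2) card_alive_le_width[of \<sigma>] width_snoc_ge[of \<sigma> e] by linarith
      fix i U assume "?h (\<sigma> @ [e]) i U ?x \<noteq> ?h (\<sigma> @ [e]) i U v"
      then show "2 powi i < linf_dist D ?x v \<or> i \<in> ?R"
        using that by (auto simp: home_snoc settle_def split: if_splits)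
    qed
    consider "u = v" | "u \<in> ?L" "v \<in> ?L" | "snd e" "?x \<notin> ?L" "u = ?x" "v \<in> ?L"
      | "snd e" "?x \<notin> ?L" "v = ?x" "u \<in> ?L"
      using snoc.prems(2,3) by (auto split: if_splits)
    then show ?case
    proof cases
      case 1
      then show ?thesis by (intro exI[of _ "{}"]) simp
    next
      case 2
      then show ?thesis using old by blast
    next
      case 3
      then show ?thesis using new by blast
    next
      case 4
      then show ?thesis using new[of u] by (simp add: linf_dist_commute eq_commute)
    qed
  qed
  then show thesis using that by blast
qed

section \<open>The random embedding\<close>

definition scale_home :: "nat \<Rightarrow> real \<Rightarrow> int \<Rightarrow> update list \<Rightarrow> point \<Rightarrow> int list" where
  "scale_home D U i = home D (2 powi i) (cell (2 powi i) U)"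

text \<open>Equal homes allow distances up to \<open>3 * 2 powi i\<close>; the weight is twice that,
  to absorb the rounding of a distance to a power of two.\<close>

definition gap :: "nat \<Rightarrow> real \<Rightarrow> update list \<Rightarrow> point \<Rightarrow> point \<Rightarrow> int \<Rightarrow> real" where
  "gap D U \<sigma> u v i = (if scale_home D U i \<sigma> u \<noteq> scale_home D U i \<sigma> v then 6 * 2 powi i else 0)"

text \<open>The supremum is shown to be bounded for alive points of valid sequences; the value 0
  elsewhere keeps evaluation measurable at all arguments.\<close>

definition shifted_embedding :: "nat \<Rightarrow> real \<Rightarrow> embedding" where
  "shifted_embedding D U \<sigma> u v =
     (if valid_seq D \<sigma> \<and> u \<in> alive \<sigma> \<and> v \<in> alive \<sigma> then SUP i. gap D U \<sigma> u v i else 0)"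

text \<open>A scale with different homes is either below the distance, or lies in \<open>R\<close>
  with different cells. The bound is uniform in \<open>i\<close>, so it passes to the supremum, and
  \<open>R\<close> is fixed before \<open>U\<close>, so it can be integrated term by term.\<close>

lemma gap_le:
  assumes "valid_seq D \<sigma>" "u \<in> alive \<sigma>" "v \<in> alive \<sigma>"
  obtains R :: "int set" where "finite R" "card R \<le> 2 * width \<sigma>"
    "\<And>U i. gap D U \<sigma> u v i \<le> 6 * linf_dist D u v +
       (\<Sum>j\<in>R. 6 * 2 powi j * indicator {U. cell (2 powi j) U u \<noteq> cell (2 powi j) U v} U)"
proof -
  obtain R :: "int set" where R: "finite R" "card R \<le> 2 * width \<sigma>"
    "\<And>i U. scale_home D U i \<sigma> u \<noteq> scale_home D U i \<sigma> v \<Longrightarrow> 2 powi i < linf_dist D u v \<or> i \<in> R"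
    using home_neq_scales[OF assms] unfolding scale_home_def by metis
  have "gap D U \<sigma> u v i \<le> 6 * linf_dist D u v +
       (\<Sum>j\<in>R. 6 * 2 powi j * indicator {U. cell (2 powi j) U u \<noteq> cell (2 powi j) U v} U)"
    (is "_ \<le> _ + (\<Sum>j\<in>R. ?f j)") for U i
  proof -
    have nonneg: "?f j \<ge> 0" for j by simp
    then have sum0: "(\<Sum>j\<in>R. ?f j) \<ge> 0" by (intro sum_nonneg) auto
    consider "scale_home D U i \<sigma> u = scale_home D U i \<sigma> v"
      | "scale_home D U i \<sigma> u \<noteq> scale_home D U i \<sigma> v" "2 powi i < linf_dist D u v"
      | "scale_home D U i \<sigma> u \<noteq> scale_home D U i \<sigma> v" "i \<in> R"
      using R(3) by blast
    then show ?thesis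
    proof cases
      case 3
      have "cell (2 powi i) U u \<noteq> cell (2 powi i) U v"
        using 3(1) home_eq_of_cell_eq[OF _ assms, of "2 powi i" U] by (auto simp: scale_home_def)
      then have "gap D U \<sigma> u v i \<le> ?f i" by (simp add: gap_def)
      also have "\<dots> \<le> (\<Sum>j\<in>R. ?f j)" using nonneg 3(2) R(1) by (intro member_le_sum) auto
      finally show ?thesis using linf_dist_nonneg[of D u v] by linarith
    qed (use sum0 linf_dist_nonneg[of D u v] in \<open>auto simp: gap_def\<close>)
  qed
  then show thesis using that R by blast
qed

lemma bdd_above_gap:
  assumes "valid_seq D \<sigma>" "u \<in> alive \<sigma>" "v \<in> alive \<sigma>"
  shows "bdd_above (range (gap D U \<sigma> u v))"
proof -
  obtain R :: "int set" where "finite R" "card R \<le> 2 * width \<sigma>"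
    and "\<And>U i. gap D U \<sigma> u v i \<le> 6 * linf_dist D u v +
       (\<Sum>j\<in>R. 6 * 2 powi j * indicator {U. cell (2 powi j) U u \<noteq> cell (2 powi j) U v} U)"
    using gap_le[OF assms] by blast
  then show ?thesis by (intro bdd_aboveI2)
qed

lemma shifted_embedding_eq:
  assumes "valid_seq D \<sigma>" "u \<in> alive \<sigma>" "v \<in> alive \<sigma>"
  shows "shifted_embedding D U \<sigma> u v = (SUP i. gap D U \<sigma> u v i)"
  using assms by (simp add: shifted_embedding_def)

lemma gap_le_shifted_embedding:
  assumes "valid_seq D \<sigma>" "u \<in> alive \<sigma>" "v \<in> alive \<sigma>"
  shows "gap D U \<sigma> u v i \<le> shifted_embedding D U \<sigma> u v"
  unfolding shifted_embedding_eq[OF assms] by (rule cSUP_upper[OF UNIV_I bdd_above_gap[OF assms]])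

lemma shifted_embedding_leI:
  assumes "valid_seq D \<sigma>" "u \<in> alive \<sigma>" "v \<in> alive \<sigma>" "\<And>i. gap D U \<sigma> u v i \<le> c"
  shows "shifted_embedding D U \<sigma> u v \<le> c"
  unfolding shifted_embedding_eq[OF assms(1-3)] by (rule cSUP_least) (use assms(4) in auto)

lemma shifted_embedding_self:
  assumes "valid_seq D \<sigma>" "u \<in> alive \<sigma>"
  shows "shifted_embedding D U \<sigma> u u = 0"
  unfolding shifted_embedding_eq[OF assms assms(2)] by (simp add: gap_def)

section \<open>Domination, the HST property and monotonicity\<close>

lemma shifted_embedding_dominates:
  assumes "valid_seq D \<sigma>" "u \<in> alive \<sigma>" "v \<in> alive \<sigma>"
  shows "linf_dist D u v \<le> shifted_embedding D U \<sigma> u v"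
proof (cases "u = v")
  case True
  then show ?thesis using shifted_embedding_self[OF assms(1,2)] by (simp add: linf_dist_self)
next
  case False
  have d: "linf_dist D u v > 0"
    using linf_dist_pos[OF length_alive[OF assms(1,2)] length_alive[OF assms(1,3)] False] .
  \<comment> \<open>This is the largest \<open>i\<close> with
    \<open>3 * 2 powi i < linf_dist D u v\<close>: homes at this scale must differ, and
    \<open>6 * 2 powi i\<close> already reaches the distance.\<close>
  define i where "i = \<lceil>log 2 (linf_dist D u v / 3)\<rceil> - 1"
  have eq: "2 powi j = 2 powr real_of_int j" for j by (simp add: powr_real_of_int')
  have "real_of_int i < log 2 (linf_dist D u v / 3)" "log 2 (linf_dist D u v / 3) \<le> real_of_int i + 1"
    unfolding i_def by linarith+
  then have lo: "3 * 2 powi i < linf_dist D u v" and hi: "linf_dist D u v \<le> 6 * 2 powi i"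
    using d by (simp_all add: eq less_log_iff log_le_iff powr_add)
  have "scale_home D U i \<sigma> u \<noteq> scale_home D U i \<sigma> v"
    using linf_dist_le_of_home_eq[OF _ assms, of "2 powi i" U] lo by (auto simp: scale_home_def)
  then have "linf_dist D u v \<le> gap D U \<sigma> u v i" using hi by (simp add: gap_def)
  then show ?thesis using gap_le_shifted_embedding[OF assms, of U i] by linarith
qed

lemma hst_metric_shifted_embedding:
  assumes "valid_seq D \<sigma>"
  shows "hst_metric (alive \<sigma>) (shifted_embedding D U \<sigma>)"
proof (rule ultrametric_imp_hst_metric)
  show "finite (alive \<sigma>)" by (rule finite_alive)
  show "shifted_embedding D U \<sigma> x x = 0" if "x \<in> alive \<sigma>" for x
    using shifted_embedding_self assms that .
  show "shifted_embedding D U \<sigma> x y > 0" if "x \<in> alive \<sigma>" "y \<in> alive \<sigma>" "x \<noteq> y" for x y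
    using shifted_embedding_dominates[OF assms that(1,2), of U]
      linf_dist_pos[OF length_alive[OF assms that(1)] length_alive[OF assms that(2)] that(3)] by linarith
  show "shifted_embedding D U \<sigma> x y = shifted_embedding D U \<sigma> y x"
    if "x \<in> alive \<sigma>" "y \<in> alive \<sigma>" for x y
    using that by (simp add: shifted_embedding_def gap_def eq_commute)
  show "shifted_embedding D U \<sigma> x z \<le> max (shifted_embedding D U \<sigma> x y) (shifted_embedding D U \<sigma> y z)"
    if xyz: "x \<in> alive \<sigma>" "y \<in> alive \<sigma>" "z \<in> alive \<sigma>" for x y z
  proof (rule shifted_embedding_leI[OF assms xyz(1,3)])
    fix i
    \<comment> \<open>If the homes of \<open>x\<close> and \<open>z\<close> differ, the home of
      \<open>y\<close> differs from one of them.\<close>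
    have "gap D U \<sigma> x z i \<le> max (gap D U \<sigma> x y i) (gap D U \<sigma> y z i)"
      by (auto simp: gap_def)
    also have "\<dots> \<le> max (shifted_embedding D U \<sigma> x y) (shifted_embedding D U \<sigma> y z)"
      by (intro max.mono gap_le_shifted_embedding assms xyz)
    finally show "gap D U \<sigma> x z i \<le> \<dots>" .
  qed
qed

text \<open>Equal homes persist, so the gap at each scale either stays or drops to 0.\<close>

lemma shifted_embedding_snoc_le:
  assumes "valid_seq D (\<sigma> @ [e])" "u \<in> alive \<sigma>" "v \<in> alive \<sigma>"
    "u \<in> alive (\<sigma> @ [e])" "v \<in> alive (\<sigma> @ [e])"
  shows "shifted_embedding D U (\<sigma> @ [e]) u v \<le> shifted_embedding D U \<sigma> u v"
proof (rule shifted_embedding_leI[OF assms(1,4,5)])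
  fix i
  have val: "valid_seq D \<sigma>" using assms(1) by (simp add: valid_seq_snoc)
  have "gap D U (\<sigma> @ [e]) u v i \<le> gap D U \<sigma> u v i"
    using home_eq_preserved[OF _ assms(1-3), of "2 powi i" U] by (auto simp: gap_def scale_home_def)
  then show "gap D U (\<sigma> @ [e]) u v i \<le> shifted_embedding D U \<sigma> u v"
    using gap_le_shifted_embedding[OF val assms(2,3), of U i] by linarith
qed

lemma det_monotone_shifted_embedding: "det_monotone_embedding D (shifted_embedding D U)"
  unfolding det_monotone_embedding_def
proof (intro allI impI conjI ballI)
  fix \<sigma> t assume "valid_seq D \<sigma>"
  then have val: "valid_seq D (take t \<sigma>)" by (rule valid_seq_take)
  show "hst_metric (alive (take t \<sigma>)) (shifted_embedding D U (take t \<sigma>))"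
    by (rule hst_metric_shifted_embedding[OF val])
  show "linf_dist D u v \<le> shifted_embedding D U (take t \<sigma>) u v"
    if "u \<in> alive (take t \<sigma>)" "v \<in> alive (take t \<sigma>)" for u v
    by (rule shifted_embedding_dominates[OF val that])
next
  fix \<sigma> t u v assume *: "valid_seq D \<sigma>" "1 \<le> t \<and> t \<le> length \<sigma>"
    "u \<in> alive (take (t - 1) \<sigma>) \<inter> alive (take t \<sigma>)" "v \<in> alive (take (t - 1) \<sigma>) \<inter> alive (take t \<sigma>)"
  have eq: "take t \<sigma> = take (t - 1) \<sigma> @ [\<sigma> ! (t - 1)]"
    using *(2) by (cases t) (simp_all add: take_Suc_conv_app_nth)
  show "shifted_embedding D U (take t \<sigma>) u v \<le> shifted_embedding D U (take (t - 1) \<sigma>) u v"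
    using shifted_embedding_snoc_le[of D "take (t - 1) \<sigma>" "\<sigma> ! (t - 1)" u v U]
      *(3,4) valid_seq_take[OF *(1), of t] unfolding eq by blast
qed

section \<open>Measurability and expectation\<close>

lemma measurable_map_count_space:
  fixes f :: "'a \<Rightarrow> 'b \<Rightarrow> 'c :: countable"
  assumes "\<And>x. x \<in> set xs \<Longrightarrow> f x \<in> measurable M (count_space UNIV)"
  shows "(\<lambda>w. map (\<lambda>x. f x w) xs) \<in> measurable M (count_space UNIV)"
  using assms
proof (induction xs)
  case Nil
  then show ?case by simp
next
  case (Cons a xs)
  have "(\<lambda>w. map (\<lambda>x. f x w) xs) \<in> measurable M (count_space UNIV)" using Cons by simp
  then have "(\<lambda>w. c # map (\<lambda>x. f x w) xs) \<in> measurable M (count_space UNIV)" for c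
    by (rule measurable_compose) simp
  then show ?case
    using measurable_compose_countable[of "\<lambda>c w. c # map (\<lambda>x. f x w) xs" M "count_space UNIV" "f a"] Cons
    by simp
qed

lemma measurable_cell: "(\<lambda>U. cell s U x) \<in> measurable borel (count_space UNIV)"
  unfolding cell_def by (rule measurable_map_count_space) measurable

text \<open>The gap factors through \<open>key U\<close>, the list of cells of all points in the
  sequence. This list ranges over a countable type, on which every function is measurable, including
  one defined by \<open>SOME\<close>.\<close>

lemma borel_measurable_gap:
  assumes "u \<in> alive \<sigma>" "v \<in> alive \<sigma>"
  shows "(\<lambda>U. gap D U \<sigma> u v i) \<in> borel_measurable borel"
proof -
  let ?s = "2 powi i :: real" and ?xs = "map fst \<sigma>"
  define key where "key U = map (cell ?s U) ?xs" for U
  \<comment> \<open>\<open>G ks\<close> recovers the cell of a point by lookup; it is unspecified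
    outside the sequence, as \<open>home_cong\<close> permits.\<close>
  define G where "G ks x = the (map_of (zip ?xs ks) x)" for ks :: "int list list" and x
  have "scale_home D U i \<sigma> w = home D ?s (G (key U)) \<sigma> w" if "w \<in> alive \<sigma>" for U w
    unfolding scale_home_def
    by (rule home_cong[OF _ that]) (simp add: G_def key_def map_of_zip_map del: map_map)
  then have eq: "(\<lambda>U. gap D U \<sigma> u v i) = (\<lambda>U. (\<lambda>ks. if home D ?s (G ks) \<sigma> u \<noteq> home D ?s (G ks) \<sigma> v
      then 6 * ?s else 0) (key U))"
    using assms by (simp add: gap_def fun_eq_iff)
  have "key \<in> measurable borel (count_space UNIV)"
    unfolding key_def by (rule measurable_map_count_space) (rule measurable_cell)
  then show ?thesis unfolding eq by (rule measurable_compose) simp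
qed

lemma borel_measurable_shifted_embedding:
  "(\<lambda>U. shifted_embedding D U \<sigma> u v) \<in> borel_measurable borel"
proof (cases "valid_seq D \<sigma> \<and> u \<in> alive \<sigma> \<and> v \<in> alive \<sigma>")
  case True
  then have "(\<lambda>U. SUP i. gap D U \<sigma> u v i) \<in> borel_measurable borel"
    by (intro borel_measurable_cSUP borel_measurable_gap bdd_above_gap) auto
  then show ?thesis using True by (simp add: shifted_embedding_def)
next
  case False
  then show ?thesis unfolding shifted_embedding_def by (simp only: if_False) simp
qed

section \<open>The uniform shift and the probability of separation\<close>

definition shift_measure :: "real measure" where
  "shift_measure = uniform_measure lborel {0..1}"

lemma space_shift_measure [simp]: "space shift_measure = UNIV"
  and sets_shift_measure [simp, measurable_cong]: "sets shift_measure = sets borel"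
  by (simp_all add: shift_measure_def)

lemma prob_space_shift_measure: "prob_space shift_measure"
  unfolding shift_measure_def by (rule prob_space_uniform_measure) auto

interpretation shift: prob_space shift_measure
  by (rule prob_space_shift_measure)

text \<open>The factor 2 is not optimal: the set is covered by two intervals of length \<open>\<bar>a - b\<bar>\<close>,
  since an integer separating \<open>a + U\<close> from \<open>b + U\<close> has only two possible values.\<close>
lemma prob_floor_neq:
  "shift.prob {U. \<lfloor>a + U\<rfloor> \<noteq> \<lfloor>b + U\<rfloor>} \<le> 2 * \<bar>a - b\<bar>"
proof -
  have *: "shift.prob {U. \<lfloor>a + U\<rfloor> \<noteq> \<lfloor>b + U\<rfloor>} \<le> 2 * (b - a)" if "a \<le> b" for a b :: real
  proof (cases "b - a < 1")
    case False
    then have "1 \<le> 2 * (b - a)" by simp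
    then show ?thesis by (rule order_trans[OF shift.prob_le_1])
  next
    case True
    \<comment> \<open>A separating integer \<open>m\<close> satisfies \<open>a < m < a + 2\<close>,
      so it is \<open>n\<close> or \<open>n + 1\<close>; \<open>?A\<close> and \<open>?B\<close>
      collect the shifts for these two values.\<close>
    define n where "n = real_of_int \<lfloor>a\<rfloor> + 1"
    let ?A = "{n - b..n - a}" and ?B = "{n + 1 - b..n + 1 - a}"
    have sub: "{0..1} \<inter> {U. \<lfloor>a + U\<rfloor> \<noteq> \<lfloor>b + U\<rfloor>} \<subseteq> ?A \<union> ?B"
    proof
      fix U assume U: "U \<in> {0..1} \<inter> {U. \<lfloor>a + U\<rfloor> \<noteq> \<lfloor>b + U\<rfloor>}"
      define m where "m = \<lfloor>b + U\<rfloor>"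
      have "\<lfloor>a + U\<rfloor> \<le> m" unfolding m_def by (rule floor_mono) (use that in simp)
      then have "\<lfloor>a + U\<rfloor> < m" using U unfolding m_def by simp
      then have m: "a + U < real_of_int m" "real_of_int m \<le> b + U"
        unfolding m_def by (simp_all add: floor_less_iff)
      have "m = \<lfloor>a\<rfloor> + 1 \<or> m = \<lfloor>a\<rfloor> + 2" using m U True by simp linarith
      then show "U \<in> ?A \<union> ?B" using m by (auto simp: n_def)
    qed
    have fm: "?A \<in> fmeasurable lborel" "?B \<in> fmeasurable lborel"
      by (auto intro!: fmeasurableI simp: emeasure_lborel_Icc_eq)
    have "shift.prob {U. \<lfloor>a + U\<rfloor> \<noteq> \<lfloor>b + U\<rfloor>} = measure lborel ({0..1} \<inter> {U. \<lfloor>a + U\<rfloor> \<noteq> \<lfloor>b + U\<rfloor>})"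
      unfolding shift_measure_def by (subst measure_uniform_measure) auto
    also have "\<dots> \<le> measure lborel (?A \<union> ?B)"
      using fm by (intro measure_mono_fmeasurable[OF sub] fmeasurable.Un) auto
    also have "\<dots> \<le> measure lborel ?A + measure lborel ?B"
      by (rule measure_Un_le) auto
    also have "\<dots> = 2 * (b - a)" using that by simp
    finally show ?thesis .
  qed
  show ?thesis
  proof (cases "a \<le> b")
    case True
    then show ?thesis using *[OF True] by simp
  next
    case False
    then show ?thesis using *[of b a] by (simp add: eq_commute)
  qed
qed

text \<open>A union bound over the coordinates, which is where the factor \<open>D\<close> of the
  distortion enters. It needs no independence, so one \<open>U\<close> can shift all
  coordinates.\<close>

lemma prob_cell_neq:
  assumes "s > 0" "length u = D" "length v = D"
  shows "shift.prob {U. cell s U u \<noteq> cell s U v} \<le> 2 * real D * linf_dist D u v / s"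
proof -
  let ?E = "\<lambda>k. {U. \<lfloor>u ! k / s + U\<rfloor> \<noteq> \<lfloor>v ! k / s + U\<rfloor>}"
  have "{U. cell s U u \<noteq> cell s U v} = (\<Union>k<D. ?E k)"
    using assms by (auto simp: cell_def list_eq_iff_nth_eq)
  then have "shift.prob {U. cell s U u \<noteq> cell s U v} \<le> (\<Sum>k<D. shift.prob (?E k))"
    by (simp only:) (rule shift.finite_measure_subadditive_finite; force)
  also have "\<dots> \<le> (\<Sum>k<D. 2 * linf_dist D u v / s)"
  proof (rule sum_mono)
    fix k assume "k \<in> {..<D}"
    then have "\<bar>u ! k - v ! k\<bar> / s \<le> linf_dist D u v / s"
      using assms(1) linf_dist_coord[of k D u v] by (simp add: divide_right_mono)
    moreover have "\<bar>u ! k / s - v ! k / s\<bar> = \<bar>u ! k - v ! k\<bar> / s"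
      using assms(1) by (simp add: diff_divide_distrib[symmetric] abs_divide)
    ultimately show "shift.prob (?E k) \<le> 2 * linf_dist D u v / s"
      using prob_floor_neq[of "u ! k / s" "v ! k / s"] by simp
  qed
  finally show ?thesis by (simp add: mult.assoc mult.left_commute)
qed

lemma sets_cell_neq: "{U. cell s U u \<noteq> cell s U v} \<in> sets borel"
proof -
  \<comment> \<open>The union runs over the countably many possible values \<open>c\<close> of the
    first cell.\<close>
  have "{U. cell s U u \<noteq> cell s U v} = (\<Union>c. (\<lambda>U. cell s U u) -` {c} \<inter> (\<lambda>U. cell s U v) -` (- {c}))"
    by auto
  also have "\<dots> \<in> sets borel"
    using measurable_sets[OF measurable_cell] by (intro sets.countable_UN'' sets.Int) auto
  finally show ?thesis .
qed

text \<open>At a scale \<open>j\<close> in \<open>R\<close> the weight \<open>6 * 2 powi j\<close>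
  cancels the denominator of the separation probability, leaving \<open>12 * D * d\<close> for the
  distance \<open>d\<close>. With at most \<open>2 * width \<sigma>\<close> such scales and the term
  \<open>6 * d\<close>, the constant is 6 + 24 = 30.\<close>

lemma nn_integral_shifted_embedding_le:
  assumes "valid_seq D \<sigma>" "u \<in> alive \<sigma>" "v \<in> alive \<sigma>"
  shows "(\<integral>\<^sup>+ U. ennreal (shifted_embedding D U \<sigma> u v) \<partial>shift_measure)
           \<le> ennreal (30 * real D * real (width \<sigma>) * linf_dist D u v)"
proof -
  let ?d = "linf_dist D u v"
  obtain R :: "int set" where R: "finite R" "card R \<le> 2 * width \<sigma>"
    "\<And>U i. gap D U \<sigma> u v i \<le> 6 * ?d +
       (\<Sum>j\<in>R. 6 * 2 powi j * indicator {U. cell (2 powi j) U u \<noteq> cell (2 powi j) U v} U)"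
    using gap_le[OF assms] by blast
  let ?E = "\<lambda>j. {U. cell (2 powi j) U u \<noteq> cell (2 powi j) U v}"
  let ?f = "\<lambda>U. 6 * ?d + (\<Sum>j\<in>R. 6 * 2 powi j * indicator (?E j) U)"
  have int: "integrable shift_measure (\<lambda>U. 6 * 2 powi j * indicator (?E j) U :: real)" for j
    using sets_cell_neq by (intro integrable_mult_right integrable_real_indicator) (auto simp: less_top[symmetric])
  have "(\<integral>\<^sup>+ U. ennreal (shifted_embedding D U \<sigma> u v) \<partial>shift_measure) \<le> (\<integral>\<^sup>+ U. ennreal (?f U) \<partial>shift_measure)"
    by (intro nn_integral_mono ennreal_leI shifted_embedding_leI assms R(3))
  also have "\<dots> = ennreal (\<integral>U. ?f U \<partial>shift_measure)"
    using int linf_dist_nonneg[of D u v]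
    by (intro nn_integral_eq_integral Bochner_Integration.integrable_add Bochner_Integration.integrable_sum)
      (auto intro!: add_nonneg_nonneg sum_nonneg)
  also have "(\<integral>U. ?f U \<partial>shift_measure) = 6 * ?d + (\<Sum>j\<in>R. 6 * 2 powi j * shift.prob (?E j))"
    using int by (simp add: Bochner_Integration.integral_add Bochner_Integration.integral_sum
      shift.prob_space[simplified])
  also have "\<dots> \<le> 6 * ?d + (\<Sum>j\<in>R. 12 * real D * ?d)"
  proof (intro add_left_mono sum_mono)
    fix j
    have "shift.prob (?E j) \<le> 2 * real D * ?d / 2 powi j"
      using length_alive assms by (intro prob_cell_neq) auto
    then show "6 * 2 powi j * shift.prob (?E j) \<le> 12 * real D * ?d" by (simp add: field_simps)
  qed
  also have "\<dots> \<le> 6 * (real D * real (width \<sigma>) * ?d) + (2 * real (width \<sigma>)) * (12 * real D * ?d)"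
  proof (rule add_mono)
    \<comment> \<open>For \<open>D = 0\<close> all distances vanish; otherwise \<open>D\<close> and
      the width are at least 1, the latter because \<open>u\<close> is alive.\<close>
    have "?d \<le> real D * real (width \<sigma>) * ?d"
    proof (cases "D = 0")
      case True
      then show ?thesis by (simp add: linf_dist_def)
    next
      case False
      have "0 < card (alive \<sigma>)" using assms(2) finite_alive card_gt_0_iff by blast
      then have "1 \<le> width \<sigma>" using card_alive_le_width[of \<sigma>] by simp
      then have "1 * 1 \<le> real D * real (width \<sigma>)" using False by (intro mult_mono) auto
      then show ?thesis using linf_dist_nonneg[of D u v] by (simp add: mult_le_cancel_right1)
    qed
    then show "6 * ?d \<le> 6 * (real D * real (width \<sigma>) * ?d)" by simp
    have "real (card R) \<le> 2 * real (width \<sigma>)" using R(2) by linarith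
    then show "(\<Sum>j\<in>R. 12 * real D * ?d) \<le> (2 * real (width \<sigma>)) * (12 * real D * ?d)"
      using linf_dist_nonneg[of D u v] by (simp only: sum_constant) (intro mult_right_mono; simp)
  qed
  also have "\<dots> = 30 * real D * real (width \<sigma>) * ?d" by simp
  finally show ?thesis by (simp add: ennreal_leI)
qed

theorem mainTheorem19:
  shows "\<exists>C :: real. \<forall>D :: nat. \<exists>M :: embedding measure.
           prob_monotone_embedding D M \<and>
           (\<forall>\<sigma>. valid_seq D \<sigma> \<longrightarrow> (\<forall>t \<le> length \<sigma>.
              \<forall>u \<in> alive (take t \<sigma>). \<forall>v \<in> alive (take t \<sigma>).
                (\<integral>\<^sup>+ A. ennreal (A (take t \<sigma>) u v) \<partial>M)
                  \<le> ennreal (C * real D * real (width \<sigma>) * linf_dist D u v)))"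
proof (intro exI[of _ 30] allI)
  fix D :: nat
  define F where "F = shifted_embedding D"
  \<comment> \<open>The law of \<open>F\<close> lives on \<open>range F\<close>, since every point
    of the space must be a deterministic monotone embedding. The sigma-algebra is generated by all
    subsets with Borel preimage, so it is large enough for evaluations and keeps \<open>F\<close>
    measurable.\<close>
  define \<G> where "\<G> = {S. S \<subseteq> range F \<and> F -` S \<in> sets borel}"
  define N where "N = sigma (range F) \<G>"
  define M where "M = distr shift_measure N F"
  have \<G>: "\<G> \<subseteq> Pow (range F)" by (auto simp: \<G>_def)
  have space_N: "space N = range F" and \<G>_N: "\<G> \<subseteq> sets N"
    unfolding N_def using \<G> by (auto simp: space_measure_of_conv)
  have F: "F \<in> measurable shift_measure N"
    unfolding N_def using \<G> by (intro measurable_measure_of) (auto simp: \<G>_def)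
  have eval: "(\<lambda>A. A s u v) \<in> borel_measurable N" for s u v
  proof (rule measurableI)
    fix B :: "real set" assume B: "B \<in> sets borel"
    \<comment> \<open>Evaluation after \<open>F\<close> is the embedding as a function of the shift,
      whose measurability is known.\<close>
    have "F -` ((\<lambda>A. A s u v) -` B \<inter> range F) = (\<lambda>U. shifted_embedding D U s u v) -` B"
      by (auto simp: F_def)
    then have "(\<lambda>A. A s u v) -` B \<inter> range F \<in> \<G>"
      using measurable_sets[OF borel_measurable_shifted_embedding B, of D s u v] by (simp add: \<G>_def)
    then show "(\<lambda>A. A s u v) -` B \<inter> space N \<in> sets N" using \<G>_N space_N by auto
  qed simp
  have "prob_monotone_embedding D M"
    unfolding prob_monotone_embedding_def
  proof (intro conjI allI ballI)
    show "prob_space M" unfolding M_def by (rule shift.prob_space_distr[OF F])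
    show "det_monotone_embedding D A" if "A \<in> space M" for A
      using that det_monotone_shifted_embedding by (auto simp: M_def space_N F_def)
    show "(\<lambda>A. A s u v) \<in> borel_measurable M" for s u v using eval by (simp add: M_def)
  qed
  moreover have "(\<integral>\<^sup>+ A. ennreal (A (take t \<sigma>) u v) \<partial>M)
      \<le> ennreal (30 * real D * real (width \<sigma>) * linf_dist D u v)"
    if val: "valid_seq D \<sigma>" and uv: "u \<in> alive (take t \<sigma>)" "v \<in> alive (take t \<sigma>)" for \<sigma> t u v
  proof -
    have "(\<integral>\<^sup>+ A. ennreal (A (take t \<sigma>) u v) \<partial>M) =
        (\<integral>\<^sup>+ U. ennreal (shifted_embedding D U (take t \<sigma>) u v) \<partial>shift_measure)"
      unfolding M_def by (subst nn_integral_distr[OF F]) (use eval in \<open>auto simp: F_def\<close>)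
    also have "\<dots> \<le> ennreal (30 * real D * real (width (take t \<sigma>)) * linf_dist D u v)"
      by (rule nn_integral_shifted_embedding_le[OF valid_seq_take[OF val] uv])
    also have "\<dots> \<le> ennreal (30 * real D * real (width \<sigma>) * linf_dist D u v)"
      using width_take_le[of t \<sigma>] linf_dist_nonneg[of D u v]
      by (intro ennreal_leI mult_right_mono mult_left_mono) auto
    finally show ?thesis .
  qed
  ultimately show "\<exists>M. prob_monotone_embedding D M \<and>
       (\<forall>\<sigma>. valid_seq D \<sigma> \<longrightarrow> (\<forall>t \<le> length \<sigma>. \<forall>u \<in> alive (take t \<sigma>). \<forall>v \<in> alive (take t \<sigma>).
          (\<integral>\<^sup>+ A. ennreal (A (take t \<sigma>) u v) \<partial>M)
            \<le> ennreal (30 * real D * real (width \<sigma>) * linf_dist D u v)))"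
    by blast
qed

end
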